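(* Let $(R,\mathfrak m)$ be a Noetherian local ring (or a standard graded algebra over a field with irrelevant ideal $\mathfrak m$) of prime characteristic $p>0$, let $I$ be an $\mathfrak m$-primary ideal, and suppose that the $F$-threshold $c^I(\mathfrak m)$ exists. Then $c(I)-1\le c^I(\mathfrak m)\le c(I)$.
   Context: For $q=p^n$, $I^{[q]}=(x^q:x\in I)$. $c(I):=\inf\{b\in\mathbb N_0:\mathfrak m^{bq}H^0_{\mathfrak m}(R/I^{[q]})=0\ \text{for all } q=p^n\gg0\}$, where $H^0_{\mathfrak m}(M)$ is the submodule of elements of $M$ annihilated by some power of $\mathfrak m$. For an ideal $J\subseteq\operatorname{rad}(I)$ put $v(q):=\sup\{\ell:J^\ell\nsubseteq I^{[q]}\}$, $c_+^I(J)=\limsup_{n\to\infty}v(q)/q$ and $c_-^I(J)=\liminf_{n\to\infty}v(q)/q$; when these coincide, the common value is the $F$-threshold, denoted $c^I(J)$ (and one says that $c^I(J)$ exists). Here $J=\mathfrak m$. *)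

theory Defs
  imports
    "HOL-Algebra.Algebra"
    "HOL-Computational_Algebra.Primes"
    "HOL-Library.Extended_Real"
    "HOL-Library.Liminf_Limsup"
begin

section \<open>Rings\<close>

text \<open>Powers \<open>J\<^sup>n\<close> of an ideal are written \<open>J [^]\<^bsub>ideals_set R\<^esub> n\<close>: they are the powers in the
  library's multiplicative monoid of ideals, so that \<open>J\<^sup>0\<close> is the whole ring.\<close>

definition ring_char :: "('a, 'b) ring_scheme \<Rightarrow> nat" where
  "ring_char R = group.ord (add_monoid R) \<one>\<^bsub>R\<^esub>"

locale local_ring = cring R + maximalideal \<mm> R for R (structure) and \<mm> +
  assumes unique_maximal: "maximalideal M R \<Longrightarrow> M = \<mm>"

text \<open>The ground field is identified with the degree-zero component, and
  \<open>generated_in_degree_one\<close> includes finite generation over the ground field.\<close>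

locale standard_graded_algebra = cring R + subfield K R
  for K :: "'a set" and R :: "('a, 'b) ring_scheme" (structure) and \<G> :: "nat \<Rightarrow> 'a set" +
  assumes component_subgroup: "subgroup (\<G> n) (add_monoid R)"
    and direct_sum: "x \<in> carrier R \<Longrightarrow>
      \<exists>!f. (\<forall>n. f n \<in> \<G> n) \<and> finite {n. f n \<noteq> \<zero>} \<and> x = (\<Oplus>n\<in>{n. f n \<noteq> \<zero>}. f n)"
    and graded_mult: "\<lbrakk>a \<in> \<G> i; b \<in> \<G> j\<rbrakk> \<Longrightarrow> a \<otimes> b \<in> \<G> (i + j)"
    and degree_zero: "\<G> 0 = K"
    and generated_in_degree_one:
      "\<exists>S. finite S \<and> S \<subseteq> \<G> 1 \<and> generate_ring R (K \<union> S) = carrier R"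

definition irrelevant_ideal :: "('a, 'b) ring_scheme \<Rightarrow> (nat \<Rightarrow> 'a set) \<Rightarrow> 'a set" where
  "irrelevant_ideal R \<G> =
     {\<Oplus>\<^bsub>R\<^esub>n\<in>{1..N}. f n | f N. \<forall>n\<in>{1..N::nat}. f n \<in> \<G> n}"

locale primary_ideal = ideal Q R for Q and R (structure) +
  assumes proper: "Q \<noteq> carrier R"
    and primary: "\<lbrakk>a \<in> carrier R; b \<in> carrier R; a \<otimes> b \<in> Q; a \<notin> Q\<rbrakk> \<Longrightarrow> \<exists>n::nat. b [^] n \<in> Q"

definition ideal_rad :: "('a, 'b) ring_scheme \<Rightarrow> 'a set \<Rightarrow> 'a set" where
  "ideal_rad R I = {x \<in> carrier R. \<exists>n::nat. x [^]\<^bsub>R\<^esub> n \<in> I}"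

definition is_primary_to :: "('a, 'b) ring_scheme \<Rightarrow> 'a set \<Rightarrow> 'a set \<Rightarrow> bool" where
  "is_primary_to R \<mm> I \<longleftrightarrow> primary_ideal I R \<and> ideal_rad R I = \<mm>"

definition frobenius_power :: "('a, 'b) ring_scheme \<Rightarrow> 'a set \<Rightarrow> nat \<Rightarrow> 'a set" where
  "frobenius_power R I q = Idl\<^bsub>R\<^esub> {x [^]\<^bsub>R\<^esub> q | x. x \<in> I}"


section \<open>Modules\<close>

definition quot_module :: "('a, 'b) ring_scheme \<Rightarrow> 'a set \<Rightarrow> ('a, 'a set) module" where
  "quot_module R J =
     \<lparr>carrier = carrier (R Quot J), monoid.mult = monoid.mult (R Quot J), one = one (R Quot J),
      ring.zero = ring.zero (R Quot J), add = add (R Quot J),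
      smult = (\<lambda>r x. (J +>\<^bsub>R\<^esub> r) \<otimes>\<^bsub>R Quot J\<^esub> x)\<rparr>"

lemma quot_module_is_module:
  assumes "cring R" and "ideal J R"
  shows "module R (quot_module R J)"
proof -
  interpret cring R by fact
  interpret J: ideal J R by fact
  interpret Q: cring "R Quot J"
    by (rule J.quotient_is_cring[OF assms(1)])
  interpret h: ring_hom_ring R "R Quot J" "a_r_coset R J"
    by (rule J.rcos_ring_hom_ring)
  have "abelian_group (quot_module R J)"
  proof (rule abelian_groupI)
    fix x assume "x \<in> carrier (quot_module R J)"
    then show "\<exists>y\<in>carrier (quot_module R J).
        y \<oplus>\<^bsub>quot_module R J\<^esub> x = \<zero>\<^bsub>quot_module R J\<^esub>"
      by (auto simp: quot_module_def intro!: bexI[of _ "\<ominus>\<^bsub>R Quot J\<^esub> x"] Q.l_neg)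
  qed (auto simp: quot_module_def Q.a_ac)
  then show ?thesis
    by (intro moduleI assms(1)) (auto simp: quot_module_def Q.l_distr Q.r_distr Q.m_assoc)
qed

text \<open>The module \<open>H\<^sup>0\<^sub>J(M)\<close>.\<close>

definition local_cohomology_zero ::
    "('a, 'b) ring_scheme \<Rightarrow> 'a set \<Rightarrow> ('a, 'm, 'c) module_scheme \<Rightarrow> 'm set" where
  "local_cohomology_zero R J M =
     {x \<in> carrier M. \<exists>n::nat. \<forall>r \<in> J [^]\<^bsub>ideals_set R\<^esub> n. r \<odot>\<^bsub>M\<^esub> x = \<zero>\<^bsub>M\<^esub>}"

text \<open>The product \<open>A N\<close> of an ideal \<open>A\<close> and a submodule \<open>N\<close> of \<open>M\<close>.\<close>

definition ideal_smult ::
    "('a, 'b) ring_scheme \<Rightarrow> ('a, 'm, 'c) module_scheme \<Rightarrow> 'a set \<Rightarrow> 'm set \<Rightarrow> 'm set" where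
  "ideal_smult R M A N =
     \<Inter>{L. submodule L R M \<and> (\<forall>r\<in>A. \<forall>x\<in>N. r \<odot>\<^bsub>M\<^esub> x \<in> L)}"


section \<open>The invariants\<close>

text \<open>All invariants are extended reals, with \<open>Inf {} = \<infinity>\<close>; \<open>q\<close> runs over the powers \<open>p ^ n\<close>.\<close>

definition c_number :: "('a, 'b) ring_scheme \<Rightarrow> 'a set \<Rightarrow> nat \<Rightarrow> 'a set \<Rightarrow> ereal" where
  "c_number R \<mm> p I =
     Inf {ereal (real b) | b :: nat. \<forall>\<^sub>F n in sequentially.
       (let q = p ^ n; M = quot_module R (frobenius_power R I q)
        in ideal_smult R M (\<mm> [^]\<^bsub>ideals_set R\<^esub> (b * q)) (local_cohomology_zero R \<mm> M) = {\<zero>\<^bsub>M\<^esub>})}"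

definition F_nu :: "('a, 'b) ring_scheme \<Rightarrow> 'a set \<Rightarrow> 'a set \<Rightarrow> nat \<Rightarrow> ereal" where
  "F_nu R I J q =
     Sup {ereal (real l) | l :: nat. \<not> J [^]\<^bsub>ideals_set R\<^esub> l \<subseteq> frobenius_power R I q}"

definition c_plus :: "('a, 'b) ring_scheme \<Rightarrow> nat \<Rightarrow> 'a set \<Rightarrow> 'a set \<Rightarrow> ereal" where
  "c_plus R p I J = limsup (\<lambda>n. F_nu R I J (p ^ n) / ereal (real (p ^ n)))"

definition c_minus :: "('a, 'b) ring_scheme \<Rightarrow> nat \<Rightarrow> 'a set \<Rightarrow> 'a set \<Rightarrow> ereal" where
  "c_minus R p I J = liminf (\<lambda>n. F_nu R I J (p ^ n) / ereal (real (p ^ n)))"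

definition F_threshold_exists :: "('a, 'b) ring_scheme \<Rightarrow> nat \<Rightarrow> 'a set \<Rightarrow> 'a set \<Rightarrow> bool" where
  "F_threshold_exists R p I J \<longleftrightarrow> c_plus R p I J = c_minus R p I J"

definition F_threshold :: "('a, 'b) ring_scheme \<Rightarrow> nat \<Rightarrow> 'a set \<Rightarrow> 'a set \<Rightarrow> ereal" where
  "F_threshold R p I J = (THE c. c_plus R p I J = c \<and> c_minus R p I J = c)"

end

theory Submission
  imports Defs
begin

text \<open>The maximal ideal is generated by finitely many elements that are nilpotent modulo \<open>I\<close>, so some
  power of it lies in \<open>I\<^bsup>[q]\<^esup>\<close> and \<open>H\<^sup>0\<close> is all of \<open>R/I\<^bsup>[q]\<^esup>\<close>. Hence \<open>b\<close> is admissible for \<open>c(I)\<close> iff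
  \<open>\<mm>\<^bsup>bq\<^esup> \<subseteq> I\<^bsup>[q]\<^esup>\<close>, i.e. \<open>v(q) < bq\<close>, for all large \<open>q\<close>. An admissible \<open>b\<close> therefore bounds the limsup of
  \<open>v(q)/q\<close> from above, and an inadmissible one bounds it from below.\<close>

section \<open>Powers of ideals\<close>

context cring
begin

lemma ideals_set_simps [simp]:
  "\<one>\<^bsub>ideals_set R\<^esub> = carrier R"
  "A \<otimes>\<^bsub>ideals_set R\<^esub> B = A \<cdot> B"
  by (simp_all add: ideals_set_def)

lemma ideal_pow_Suc:
  "J [^]\<^bsub>ideals_set R\<^esub> Suc n = (J [^]\<^bsub>ideals_set R\<^esub> n) \<cdot> J"
  by simp

lemma ideal_pow_ideal:
  assumes "ideal J R"
  shows "ideal (J [^]\<^bsub>ideals_set R\<^esub> (n::nat)) R"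
  by (induction n) (simp_all add: oneideal ideal_prod_is_ideal assms)

lemma ideal_prod_mono: "A \<subseteq> A' \<Longrightarrow> B \<subseteq> B' \<Longrightarrow> A \<cdot> B \<subseteq> A' \<cdot> B'"
proof
  fix x assume "A \<subseteq> A'" "B \<subseteq> B'" "x \<in> A \<cdot> B"
  from this(3) show "x \<in> A' \<cdot> B'"
    by induction (use \<open>A \<subseteq> A'\<close> \<open>B \<subseteq> B'\<close> in \<open>auto intro: ideal_prod.intros\<close>)
qed

lemma ideal_pow_antimono:
  assumes "ideal J R" and "m \<le> (n::nat)"
  shows "J [^]\<^bsub>ideals_set R\<^esub> n \<subseteq> J [^]\<^bsub>ideals_set R\<^esub> m"
  using assms(2)
proof (induction rule: dec_induct)
  case (step n)
  then show ?case
    using ideal_prod_inter[OF ideal_pow_ideal[OF assms(1)] assms(1)] by fastforce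
qed simp

lemma elem_pow_in_ideal_pow:
  assumes "x \<in> J"
  shows "x [^] (n::nat) \<in> J [^]\<^bsub>ideals_set R\<^esub> n"
  by (induction n) (use assms in \<open>auto intro: ideal_prod.prod\<close>)

lemma ideal_pow_principal:
  assumes "x \<in> carrier R"
  shows "(PIdl x) [^]\<^bsub>ideals_set R\<^esub> (n::nat) \<subseteq> PIdl (x [^] n)"
proof (induction n)
  case 0
  have "PIdl \<one> = carrier R" using cgenideal_eq_genideal[OF one_closed] genideal_one by simp
  then show ?case by simp
next
  case (Suc n)
  have "ideal (PIdl (x [^] Suc n)) R"
    by (rule cgenideal_ideal[OF nat_pow_closed[OF assms]])
  then interpret P: ideal "PIdl (x [^] Suc n)" R .
  have "(PIdl x) [^]\<^bsub>ideals_set R\<^esub> Suc n \<subseteq> (PIdl (x [^] n)) \<cdot> (PIdl x)"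
    unfolding ideal_pow_Suc by (rule ideal_prod_mono[OF Suc.IH subset_refl])
  moreover have "y \<in> PIdl (x [^] Suc n)" if "y \<in> (PIdl (x [^] n)) \<cdot> (PIdl x)" for y
    using that
  proof induction
    case (prod i j)
    then obtain u v where uv: "u \<in> carrier R" "v \<in> carrier R" "i = u \<otimes> x [^] n" "j = v \<otimes> x"
      unfolding cgenideal_def by blast
    have "i \<otimes> j = (u \<otimes> v) \<otimes> x [^] Suc n"
      unfolding uv(3,4) nat_pow_Suc
      using assms uv(1,2) nat_pow_closed[OF assms, of n] by (simp only: m_ac m_closed)
    moreover have "u \<otimes> v \<in> carrier R" using uv(1,2) by (rule m_closed)
    ultimately show ?case
      unfolding cgenideal_def by (intro CollectI exI conjI)
  qed (rule P.a_closed)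
  ultimately show ?case by blast
qed

section \<open>Sums of ideals and their powers\<close>

lemma ideal_add_subset:
  assumes "ideal Q R" and "A \<subseteq> Q" and "B \<subseteq> Q"
  shows "A <+>\<^bsub>R\<^esub> B \<subseteq> Q"
proof -
  interpret Q: ideal Q R by fact
  show ?thesis using assms(2,3) by (auto simp: set_add_def' intro: Q.a_closed)
qed

lemma ideal_subset_add:
  assumes "ideal A R" and "ideal B R"
  shows "A \<subseteq> A <+>\<^bsub>R\<^esub> B" and "B \<subseteq> A <+>\<^bsub>R\<^esub> B"
proof -
  interpret A: ideal A R by fact
  interpret B: ideal B R by fact
  have "a = a \<oplus> \<zero>" "\<zero> \<in> B" if "a \<in> A" for a using that by auto
  then show "A \<subseteq> A <+>\<^bsub>R\<^esub> B" unfolding set_add_def' by blast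
  have "b = \<zero> \<oplus> b" "\<zero> \<in> A" if "b \<in> B" for b using that by auto
  then show "B \<subseteq> A <+>\<^bsub>R\<^esub> B" unfolding set_add_def' by blast
qed

text \<open>Expanding a product of \<open>m + n\<close> factors from the sum, each term takes at
  least \<open>m\<close> factors from \<open>A\<close> or at least \<open>n\<close> from
  \<open>B\<close>. Formally this is a double induction that splits off one factor at a
  time.\<close>

lemma ideal_pow_add_subset:
  assumes A: "ideal A R" and B: "ideal B R"
  shows "(A <+>\<^bsub>R\<^esub> B) [^]\<^bsub>ideals_set R\<^esub> (m + n)
    \<subseteq> A [^]\<^bsub>ideals_set R\<^esub> (m::nat) <+>\<^bsub>R\<^esub> B [^]\<^bsub>ideals_set R\<^esub> (n::nat)"
proof -
  define W where "W n = (A <+>\<^bsub>R\<^esub> B) [^]\<^bsub>ideals_set R\<^esub> (n::nat)" for n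
  define P where "P n = A [^]\<^bsub>ideals_set R\<^esub> (n::nat)" for n
  define Q where "Q n = B [^]\<^bsub>ideals_set R\<^esub> (n::nat)" for n
  have P: "ideal (P n) R" "P (Suc n) = P n \<cdot> A" "P 0 = carrier R" for n
    by (simp_all add: P_def ideal_pow_ideal A)
  have Q: "ideal (Q n) R" "Q (Suc n) = Q n \<cdot> B" "Q 0 = carrier R" for n
    by (simp_all add: Q_def ideal_pow_ideal B)
  have W: "ideal (W n) R" "W (Suc n) = W n \<cdot> (A <+>\<^bsub>R\<^esub> B)" for n
    by (simp_all add: W_def ideal_pow_ideal add_ideals A B)
  have W_carr: "W n \<subseteq> carrier R" for n
    using ideal.Icarr[OF W(1)] by blast
  have "W (m + n) \<subseteq> P m <+>\<^bsub>R\<^esub> Q n"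
  proof (induction m arbitrary: n)
    case 0
    show ?case
      unfolding P(3) using W_carr ideal_subset_add(1)[OF oneideal Q(1)] by (rule subset_trans)
  next
    case (Suc m)
    note outer = Suc
    show ?case
    proof (induction n)
      case 0
      show ?case
        unfolding Q(3) using W_carr ideal_subset_add(2)[OF P(1) oneideal] by (rule subset_trans)
    next
      case (Suc n)
      let ?T = "P (Suc m) <+>\<^bsub>R\<^esub> Q (Suc n)"
      have T: "ideal ?T R" by (rule add_ideals[OF P(1) Q(1)])
      note subT = subset_trans[OF _ ideal_subset_add(1)[OF P(1) Q(1)]]
        subset_trans[OF _ ideal_subset_add(2)[OF P(1) Q(1)]]
      \<comment> \<open>The last factor of the power lies in \<open>A\<close> or in
        \<open>B\<close>. In the first case the exponents drop to \<open>(m, Suc n)\<close>, which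
        is \<open>outer\<close> taken at \<open>Suc n\<close>; in the second they drop to
        \<open>(Suc m, n)\<close>, which is the inner hypothesis.\<close>
      have "W (m + Suc n) \<cdot> A \<subseteq> (P m <+>\<^bsub>R\<^esub> Q (Suc n)) \<cdot> A"
        by (rule ideal_prod_mono[OF outer subset_refl])
      also have "\<dots> = P (Suc m) <+>\<^bsub>R\<^esub> Q (Suc n) \<cdot> A"
        unfolding P(2) by (rule ideal_prod_distr(2)[OF A P(1) Q(1)])
      also have "\<dots> \<subseteq> ?T"
        using ideal_prod_inter[OF Q(1) A]
        by (intro ideal_add_subset[OF T] subT(1)[OF subset_refl] subT(2)) (rule le_infE)
      finally have 1: "W (m + Suc n) \<cdot> A \<subseteq> ?T" .
      have "W (Suc m + n) \<cdot> B \<subseteq> (P (Suc m) <+>\<^bsub>R\<^esub> Q n) \<cdot> B"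
        by (rule ideal_prod_mono[OF Suc subset_refl])
      also have "\<dots> = P (Suc m) \<cdot> B <+>\<^bsub>R\<^esub> Q (Suc n)"
        unfolding Q(2) by (rule ideal_prod_distr(2)[OF B P(1) Q(1)])
      also have "\<dots> \<subseteq> ?T"
        using ideal_prod_inter[OF P(1) B]
        by (intro ideal_add_subset[OF T] subT(2)[OF subset_refl] subT(1)) (rule le_infE)
      finally have 2: "W (Suc m + n) \<cdot> B \<subseteq> ?T" .
      have "W (Suc m + Suc n) = W (Suc m + n) \<cdot> A <+>\<^bsub>R\<^esub> W (Suc m + n) \<cdot> B"
        unfolding add_Suc_right W(2) by (rule ideal_prod_distr(1)[OF W(1) A B])
      moreover have "W (Suc m + n) \<cdot> A \<subseteq> ?T" using 1 by (simp only: add_Suc add_Suc_right)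
      ultimately show ?case using ideal_add_subset[OF T _ 2] by (simp only:)
    qed
  qed
  then show ?thesis by (simp only: W_def P_def Q_def)
qed

text \<open>Adjoining a generator \<open>s\<close> turns the ideal into
  \<open>PIdl s + Idl S\<close>. By \<open>ideal_pow_add_subset\<close> the exponents that work for
  the two summands add up to one that works for the sum.\<close>

lemma finite_nilpotent_imp_ideal_pow_subset:
  assumes "finite S" and "S \<subseteq> carrier R" and Q: "ideal Q R"
    and "\<And>s. s \<in> S \<Longrightarrow> \<exists>n::nat. s [^] n \<in> Q"
  shows "\<exists>k::nat. (Idl S) [^]\<^bsub>ideals_set R\<^esub> k \<subseteq> Q"
  using assms(1,2,4)
proof (induction S)
  case empty
  \<comment> \<open>The exponent is one because the zeroth power is the whole ring, even for the
    zero ideal.\<close>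
  have "(Idl {}) [^]\<^bsub>ideals_set R\<^esub> Suc 0 \<subseteq> carrier R \<cdot> (Idl {})"
    by simp
  also have "\<dots> \<subseteq> Idl {}"
    using ideal_prod_inter[OF oneideal genideal_ideal[OF empty_subsetI]] by (rule le_infE)
  also have "\<dots> \<subseteq> Q"
    by (rule genideal_minimal[OF Q empty_subsetI])
  finally show ?case by (rule exI)
next
  case (insert s S)
  from insert.prems(1) have s: "s \<in> carrier R" and S: "S \<subseteq> carrier R" by simp_all
  obtain n where n: "s [^] (n::nat) \<in> Q"
    using insert.prems(2) by blast
  obtain k where k: "(Idl S) [^]\<^bsub>ideals_set R\<^esub> (k::nat) \<subseteq> Q"
    using insert.IH[OF S] insert.prems(2) by blast
  note ids = cgenideal_ideal[OF s] genideal_ideal[OF S]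
  have "Idl (insert s S) = PIdl s <+>\<^bsub>R\<^esub> Idl S"
  proof
    have "insert s S \<subseteq> PIdl s <+>\<^bsub>R\<^esub> Idl S"
      using ideal_subset_add[OF ids] cgenideal_self[OF s] genideal_self[OF S] by blast
    then show "Idl (insert s S) \<subseteq> PIdl s <+>\<^bsub>R\<^esub> Idl S"
      by (rule genideal_minimal[OF add_ideals[OF ids]])
    have T: "ideal (Idl (insert s S)) R" by (rule genideal_ideal[OF insert.prems(1)])
    have "s \<in> Idl (insert s S)" "S \<subseteq> Idl (insert s S)"
      using genideal_self[OF insert.prems(1)] by simp_all
    then show "PIdl s <+>\<^bsub>R\<^esub> Idl S \<subseteq> Idl (insert s S)"
      by (intro ideal_add_subset[OF T] cgenideal_minimal[OF T] genideal_minimal[OF T])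
  qed
  moreover have "(PIdl s) [^]\<^bsub>ideals_set R\<^esub> n \<subseteq> Q"
    by (rule subset_trans[OF ideal_pow_principal[OF s] cgenideal_minimal[OF Q n]])
  ultimately have "(Idl (insert s S)) [^]\<^bsub>ideals_set R\<^esub> (n + k) \<subseteq> Q"
    using subset_trans[OF ideal_pow_add_subset[OF ids] ideal_add_subset[OF Q _ k]]
    by (simp only:)
  then show ?case by (rule exI)
qed

section \<open>Frobenius powers of an ideal\<close>

lemma frobenius_power_ideal:
  assumes "I \<subseteq> carrier R"
  shows "ideal (frobenius_power R I q) R"
  unfolding frobenius_power_def using assms by (intro genideal_ideal) auto

lemma pow_in_frobenius_power:
  assumes "I \<subseteq> carrier R" and "x \<in> I"
  shows "x [^] (q::nat) \<in> frobenius_power R I q"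
proof -
  have "{x [^] q | x. x \<in> I} \<subseteq> carrier R" using assms(1) by auto
  from genideal_self[OF this] show ?thesis
    unfolding frobenius_power_def using assms(2) by auto
qed

text \<open>Positivity of \<open>q\<close> matters: at \<open>q = 0\<close> every generator is
  \<open>\<one>\<close>. The inclusion later shows that the Frobenius powers of a proper ideal are
  proper.\<close>

lemma frobenius_power_subset:
  assumes I: "ideal I R" and "q > 0"
  shows "frobenius_power R I q \<subseteq> I"
proof -
  interpret I: ideal I R by fact
  obtain r where "q = Suc r" using \<open>q > 0\<close> by (cases q) auto
  then show ?thesis
    unfolding frobenius_power_def by (intro genideal_minimal I) (auto intro!: I.I_l_closed)
qed

section \<open>Local cohomology of the quotient\<close>

text \<open>The class of \<open>\<one>\<close> serves as the test element: \<open>r\<close> kills it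
  exactly when \<open>r\<close> lies in \<open>J\<close>.\<close>

lemma quot_module_smult_one:
  assumes "ideal J R" and "r \<in> carrier R"
  shows "r \<odot>\<^bsub>quot_module R J\<^esub> (J +> \<one>) = J +> r"
proof -
  interpret J: ideal J R by fact
  show ?thesis
    using assms(2) by (simp add: quot_module_def FactRing_def J.rcoset_mult_add)
qed

lemma quot_module_smult_zero:
  assumes J: "ideal J R" and "r \<in> J" and x: "x \<in> carrier (quot_module R J)"
  shows "r \<odot>\<^bsub>quot_module R J\<^esub> x = \<zero>\<^bsub>quot_module R J\<^esub>"
proof -
  interpret J: ideal J R by fact
  obtain y where y: "y \<in> carrier R" "x = J +> y"
    using x by (auto simp: quot_module_def FactRing_def A_RCOSETS_def')
  have "r \<otimes> y \<in> J" using assms(2) y by (auto intro: J.I_r_closed)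
  moreover have "[mod J:] (J +> r) \<Otimes> (J +> y) = J +> (r \<otimes> y)"
    using J.rcoset_mult_add J.Icarr[OF assms(2)] y(1) .
  ultimately show ?thesis
    using y(2) by (simp add: quot_module_def FactRing_def J.a_rcos_const)
qed

text \<open>Elements of \<open>J\<close> kill the whole quotient, so the single exponent
  \<open>k\<close> witnesses membership for every element at once.\<close>

lemma local_cohomology_zero_eq_carrier:
  assumes J: "ideal J R" and "\<mm> [^]\<^bsub>ideals_set R\<^esub> (k::nat) \<subseteq> J"
  shows "local_cohomology_zero R \<mm> (quot_module R J) = carrier (quot_module R J)"
  unfolding local_cohomology_zero_def using quot_module_smult_zero[OF J] assms(2) by blast

text \<open>The annihilator of \<open>R/J\<close> is \<open>J\<close>: one direction tests on the
  class of \<open>\<one>\<close>, the other uses that \<open>J\<close> acts as zero.\<close>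

lemma ideal_smult_quot_module_eq_zero_iff:
  assumes J: "ideal J R" and A: "A \<subseteq> carrier R"
  shows "ideal_smult R (quot_module R J) A (carrier (quot_module R J)) = {\<zero>\<^bsub>quot_module R J\<^esub>}
    \<longleftrightarrow> A \<subseteq> J"
proof
  interpret J: ideal J R by fact
  let ?M = "quot_module R J"
  interpret M: module R ?M
    by (rule quot_module_is_module[OF is_cring J])
  have zero: "\<zero>\<^bsub>?M\<^esub> = J" by (simp add: quot_module_def FactRing_def)
  {
    assume eq: "ideal_smult R ?M A (carrier ?M) = {\<zero>\<^bsub>?M\<^esub>}"
    show "A \<subseteq> J"
    proof
      fix r assume r: "r \<in> A"
      have "J +> \<one> \<in> carrier ?M"
        by (auto simp: quot_module_def FactRing_def A_RCOSETS_def')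
      then have "r \<odot>\<^bsub>?M\<^esub> (J +> \<one>) \<in> ideal_smult R ?M A (carrier ?M)"
        using r unfolding ideal_smult_def by blast
      then have "J +> r = J"
        using eq zero quot_module_smult_one[OF J] r A by auto
      then show "r \<in> J"
        using r A by (intro J.rcos_const_imp_mem) auto
    qed
  next
    assume "A \<subseteq> J"
    then have "\<forall>r\<in>A. \<forall>x\<in>carrier ?M. r \<odot>\<^bsub>?M\<^esub> x \<in> {\<zero>\<^bsub>?M\<^esub>}"
      using quot_module_smult_zero[OF J] by blast
    \<comment> \<open>The product is an intersection of submodules. The zero submodule is one of
      them and zero lies in each, so the intersection is exactly zero.\<close>
    moreover have "\<ominus>\<^bsub>?M\<^esub> \<zero>\<^bsub>?M\<^esub> = \<zero>\<^bsub>?M\<^esub>"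
      by (intro M.minus_equality) auto
    then have "submodule {\<zero>\<^bsub>?M\<^esub>} R ?M"
      by (intro M.submoduleI) simp_all
    moreover have "\<zero>\<^bsub>?M\<^esub> \<in> L" if "submodule L R ?M" for L
      using subgroup.one_closed[OF submodule.axioms(1)[OF that]] by simp
    ultimately show "ideal_smult R ?M A (carrier ?M) = {\<zero>\<^bsub>?M\<^esub>}"
      unfolding ideal_smult_def by blast
  }
qed

end

section \<open>Finite generation\<close>

text \<open>The set \<open>K + Idl S\<close> contains the ring generators and is closed under the
  ring operations. In a product the constants multiply, and every other term has a factor in
  \<open>Idl S\<close>.\<close>

lemma (in standard_graded_algebra) decompose_constant:
  assumes "S \<subseteq> carrier R" and "generate_ring R (K \<union> S) = carrier R" and "x \<in> carrier R"
  shows "\<exists>k\<in>K. \<exists>s\<in>Idl S. x = k \<oplus> s"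
proof -
  interpret S: ideal "Idl S" R by (rule genideal_ideal[OF assms(1)])
  note K = subringE[OF subring_axioms]
  from assms(3) have "x \<in> generate_ring R (K \<union> S)" by (simp add: assms(2))
  then show ?thesis
  proof induction
    case one
    have "\<one> = \<one> \<oplus> \<zero>" by simp
    then show ?case using K(3) S.zero_closed by blast
  next
    case (incl h)
    then show ?case
    proof
      assume "h \<in> K"
      moreover from this have "h = h \<oplus> \<zero>" using K(1) by auto
      ultimately show ?thesis using S.zero_closed by blast
    next
      assume "h \<in> S"
      moreover from this have "h = \<zero> \<oplus> h" using assms(1) by auto
      ultimately show ?thesis using K(2) genideal_self[OF assms(1)] by blast
    qed
  next
    case (a_inv h)
    then obtain k s where *: "k \<in> K" "s \<in> Idl S" "h = k \<oplus> s" by blast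
    then have "k \<in> carrier R" "s \<in> carrier R" using K(1) S.Icarr by blast+
    then have "\<ominus> h = \<ominus> k \<oplus> \<ominus> s" unfolding *(3) by (rule minus_add)
    then show ?case using K(5)[OF *(1)] S.a_inv_closed[OF *(2)] by blast
  next
    case (eng_add h h')
    then obtain k s k' s' where *: "k \<in> K" "s \<in> Idl S" "h = k \<oplus> s"
      "k' \<in> K" "s' \<in> Idl S" "h' = k' \<oplus> s'" by blast
    then have "k \<in> carrier R" "k' \<in> carrier R" "s \<in> carrier R" "s' \<in> carrier R"
      using K(1) S.Icarr by blast+
    then have "h \<oplus> h' = (k \<oplus> k') \<oplus> (s \<oplus> s')"
      unfolding *(3,6) by (simp add: a_ac)
    then show ?case using K(7)[OF *(1,4)] S.a_closed[OF *(2,5)] by blast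
  next
    case (eng_mult h h')
    then obtain k s k' s' where *: "k \<in> K" "s \<in> Idl S" "h = k \<oplus> s"
      "k' \<in> K" "s' \<in> Idl S" "h' = k' \<oplus> s'" by blast
    then have carr: "k \<in> carrier R" "k' \<in> carrier R" "s \<in> carrier R" "s' \<in> carrier R"
      using K(1) S.Icarr by blast+
    then have "h \<otimes> h' = (k \<otimes> k') \<oplus> (k \<otimes> s' \<oplus> s \<otimes> (k' \<oplus> s'))"
      unfolding *(3,6) by (simp add: l_distr r_distr a_ac)
    moreover have "k \<otimes> s' \<oplus> s \<otimes> (k' \<oplus> s') \<in> Idl S"
      using *(2,5) carr by (intro S.a_closed S.I_l_closed[of s' k] S.I_r_closed[of s]) simp_all
    ultimately show ?case using K(6)[OF *(1,4)] by blast
  qed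
qed

lemma (in standard_graded_algebra) component_1_subset_irrelevant:
  "\<G> 1 \<subseteq> irrelevant_ideal R \<G>"
proof
  fix x assume x: "x \<in> \<G> 1"
  then have "x \<in> carrier R"
    using subgroup.subset[OF component_subgroup[of 1]] by auto
  then have "x = (\<Oplus>n\<in>{1..1::nat}. (\<lambda>_. x) n)" by simp
  moreover have "\<forall>n\<in>{1..1::nat}. (\<lambda>_. x) n \<in> \<G> n" using x by auto
  ultimately show "x \<in> irrelevant_ideal R \<G>"
    unfolding irrelevant_ideal_def by blast
qed

text \<open>The degree-one generators of the algebra also generate this ideal. Both inclusions use
  its description as the radical of \<open>I\<close> instead of comparing degrees.\<close>

lemma (in standard_graded_algebra) irrelevant_ideal_finitely_generated:
  assumes I: "is_primary_to R (irrelevant_ideal R \<G>) I"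
  shows "\<exists>S. finite S \<and> S \<subseteq> carrier R \<and> irrelevant_ideal R \<G> = Idl S"
proof -
  let ?\<mm> = "irrelevant_ideal R \<G>"
  interpret I: primary_ideal I R
    using I by (simp add: is_primary_to_def)
  have rad: "?\<mm> = {x \<in> carrier R. \<exists>n::nat. x [^] n \<in> I}"
    using I by (simp add: is_primary_to_def ideal_rad_def)
  obtain S where S: "finite S" "S \<subseteq> \<G> 1" "generate_ring R (K \<union> S) = carrier R"
    using generated_in_degree_one by blast
  have S\<mm>: "S \<subseteq> ?\<mm>" using S(2) component_1_subset_irrelevant by auto
  then have Sc: "S \<subseteq> carrier R" unfolding rad by blast
  interpret Id: ideal "Idl S" R by (rule genideal_ideal[OF Sc])
  obtain k where k: "(Idl S) [^]\<^bsub>ideals_set R\<^esub> (k::nat) \<subseteq> I"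
    using finite_nilpotent_imp_ideal_pow_subset[OF S(1) Sc I.is_ideal] S\<mm> unfolding rad by blast
  \<comment> \<open>The \<open>k\<close>-th power of an element of \<open>Idl S\<close> lies in the
    \<open>k\<close>-th power of the ideal, hence in \<open>I\<close>, so the element lies in the
    radical.\<close>
  have "Idl S \<subseteq> ?\<mm>"
    unfolding rad using elem_pow_in_ideal_pow[of _ "Idl S" k] k Id.Icarr by blast
  moreover have "?\<mm> \<subseteq> Idl S"
  proof
    fix x assume x: "x \<in> ?\<mm>"
    then have xc: "x \<in> carrier R" unfolding rad by blast
    obtain c s where cs: "c \<in> K" "s \<in> Idl S" "x = c \<oplus> s"
      using decompose_constant[OF Sc S(3) xc] by blast
    have cc: "c \<in> carrier R" using cs(1) subringE(1)[OF subring_axioms] by auto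
    \<comment> \<open>A nonzero constant term would make \<open>(x, S)\<close> the unit ideal, yet \<open>(x, S)\<close> is nilpotent modulo \<open>I\<close>.\<close>
    have "c = \<zero>"
    proof (rule ccontr)
      assume "c \<noteq> \<zero>"
      then have "c \<in> Units (R \<lparr> carrier := K \<rparr>)"
        using cs(1) subfield_Units by blast
      then obtain d where d: "d \<in> K" "d \<otimes> c = \<one>"
        unfolding Units_def by auto
      have dc: "d \<in> carrier R" using d(1) subringE(1)[OF subring_axioms] by auto
      have T: "insert x S \<subseteq> carrier R" using xc Sc by auto
      interpret T: ideal "Idl (insert x S)" R by (rule genideal_ideal[OF T])
      have "Idl S \<subseteq> Idl (insert x S)" using T by (intro subset_Idl_subset) auto
      then have "s \<in> Idl (insert x S)" "x \<in> Idl (insert x S)"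
        using cs(2) genideal_self[OF T] by auto
      then have "x \<ominus> s \<in> Idl (insert x S)"
        unfolding a_minus_def by (intro T.a_closed T.a_inv_closed)
      moreover have "x \<ominus> s = c"
        unfolding cs(3) using cc Id.Icarr[OF cs(2)] by (simp add: a_minus_def a_assoc r_neg)
      ultimately have "\<one> \<in> Idl (insert x S)"
        using T.I_l_closed[OF _ dc, of c] d(2) by auto
      moreover obtain l where "(Idl (insert x S)) [^]\<^bsub>ideals_set R\<^esub> (l::nat) \<subseteq> I"
        using finite_nilpotent_imp_ideal_pow_subset[OF _ T I.is_ideal] S(1) S\<mm> x
        unfolding rad by blast
      ultimately have "\<one> \<in> I"
        using elem_pow_in_ideal_pow[of \<one> "Idl (insert x S)" l] by auto
      then show False using I.one_imp_carrier I.proper by auto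
    qed
    then show "x \<in> Idl S" using cs Id.Icarr by auto
  qed
  ultimately show ?thesis using S(1) Sc by blast
qed

section \<open>The invariants\<close>

text \<open>If \<open>s [^] n\<close> lies in \<open>I\<close>, then its \<open>q\<close>-th power,
  which is \<open>s [^] (n * q)\<close>, lies in the Frobenius power. So each generator is nilpotent
  modulo that power, and finiteness of \<open>S\<close> gives a common exponent.\<close>

lemma (in cring) primary_pow_subset_frobenius_power:
  assumes S: "finite S" "S \<subseteq> carrier R" and I: "is_primary_to R (Idl S) I"
  shows "\<exists>k::nat. (Idl S) [^]\<^bsub>ideals_set R\<^esub> k \<subseteq> frobenius_power R I q"
proof (rule finite_nilpotent_imp_ideal_pow_subset[OF S])
  interpret I: primary_ideal I R
    using I by (simp add: is_primary_to_def)
  have Ic: "I \<subseteq> carrier R" using I.Icarr by blast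
  show "ideal (frobenius_power R I q) R" by (rule frobenius_power_ideal[OF Ic])
  fix s assume s: "s \<in> S"
  then obtain n :: nat where "s [^] n \<in> I"
    using I genideal_self[OF S(2)] unfolding is_primary_to_def ideal_rad_def by auto
  from pow_in_frobenius_power[OF Ic this, of q] show "\<exists>n::nat. s [^] n \<in> frobenius_power R I q"
    using s S(2) nat_pow_pow by (metis subsetD)
qed

lemma (in cring) c_number_eq:
  assumes I: "I \<subseteq> carrier R" and m: "ideal \<mm> R"
    and pow: "\<And>q. \<exists>k::nat. \<mm> [^]\<^bsub>ideals_set R\<^esub> k \<subseteq> frobenius_power R I q"
  shows "c_number R \<mm> p I = Inf {ereal (real b) | b :: nat.
    \<forall>\<^sub>F n in sequentially. \<mm> [^]\<^bsub>ideals_set R\<^esub> (b * p ^ n) \<subseteq> frobenius_power R I (p ^ n)}"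
proof -
  have "ideal_smult R (quot_module R J) A (local_cohomology_zero R \<mm> (quot_module R J))
      = {\<zero>\<^bsub>quot_module R J\<^esub>} \<longleftrightarrow> A \<subseteq> J"
    if J: "J = frobenius_power R I q" and A: "A = \<mm> [^]\<^bsub>ideals_set R\<^esub> (l::nat)" for J A q l
  proof -
    obtain k :: nat where "\<mm> [^]\<^bsub>ideals_set R\<^esub> k \<subseteq> J" using pow J by blast
    moreover have "ideal J R" using J frobenius_power_ideal[OF I] by simp
    moreover have "A \<subseteq> carrier R"
      using A ideal.Icarr[OF ideal_pow_ideal[OF m]] by blast
    ultimately show ?thesis
      by (simp add: local_cohomology_zero_eq_carrier ideal_smult_quot_module_eq_zero_iff)
  qed
  then show ?thesis unfolding c_number_def Let_def by simp
qed

section \<open>Bounds for v(q) and for the limsup of v(q)/q\<close>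

lemma F_nu_ge:
  assumes "\<not> J [^]\<^bsub>ideals_set R\<^esub> (l::nat) \<subseteq> frobenius_power R I q"
  shows "ereal (real l) \<le> F_nu R I J q"
  unfolding F_nu_def using assms by (intro Sup_upper) auto

text \<open>Powers of \<open>J\<close> decrease, so every exponent whose power is not contained lies
  below \<open>l\<close>. If there is no such exponent, the supremum is -\<infinity> and the bound
  still holds.\<close>

lemma (in cring) F_nu_le:
  assumes "ideal J R" and "J [^]\<^bsub>ideals_set R\<^esub> (l::nat) \<subseteq> frobenius_power R I q"
  shows "F_nu R I J q \<le> ereal (real l)"
  unfolding F_nu_def
proof (rule Sup_least)
  fix x assume "x \<in> {ereal (real l) |l. \<not> J [^]\<^bsub>ideals_set R\<^esub> l \<subseteq> frobenius_power R I q}"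
  then obtain k where "x = ereal (real k)" and "\<not> J [^]\<^bsub>ideals_set R\<^esub> k \<subseteq> frobenius_power R I q"
    by blast
  then show "x \<le> ereal (real l)"
    using ideal_pow_antimono[OF assms(1), of l k] assms(2) by fastforce
qed

text \<open>Existence makes the common value unique, so \<open>THE\<close> selects the limsup and
  the estimates need only treat \<open>c_plus\<close>.\<close>

lemma F_threshold_eq_c_plus:
  "F_threshold_exists R p I J \<Longrightarrow> F_threshold R p I J = c_plus R p I J"
  unfolding F_threshold_exists_def F_threshold_def by auto

lemma (in cring) c_plus_le:
  assumes m: "ideal \<mm> R" and "p > 0"
    and ev: "\<forall>\<^sub>F n in sequentially. \<mm> [^]\<^bsub>ideals_set R\<^esub> (b * p ^ n) \<subseteq> frobenius_power R I (p ^ n)"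
  shows "c_plus R p I \<mm> \<le> ereal (real b)"
  unfolding c_plus_def
proof (rule Limsup_bounded, use ev in \<open>rule eventually_mono\<close>)
  fix n assume "\<mm> [^]\<^bsub>ideals_set R\<^esub> (b * p ^ n) \<subseteq> frobenius_power R I (p ^ n)"
  from F_nu_le[OF m this]
  show "F_nu R I \<mm> (p ^ n) / ereal (real (p ^ n)) \<le> ereal (real b)"
    using \<open>p > 0\<close> by (simp add: ereal_divide_le_pos mult.commute)
qed

text \<open>Failure of containment for infinitely many \<open>n\<close> is enough for a limsup: were
  it below \<open>b\<close>, then v(q) < bq eventually, which forces the containment for all large
  \<open>n\<close>.\<close>

lemma c_plus_ge:
  assumes "p > 0"
    and fr: "\<not> (\<forall>\<^sub>F n in sequentially. \<mm> [^]\<^bsub>ideals_set R\<^esub> (b * p ^ n) \<subseteq> frobenius_power R I (p ^ n))"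
  shows "ereal (real b) \<le> c_plus R p I \<mm>"
  unfolding c_plus_def
proof (rule ccontr, unfold not_le)
  assume "limsup (\<lambda>n. F_nu R I \<mm> (p ^ n) / ereal (real (p ^ n))) < ereal (real b)"
  then have "\<forall>\<^sub>F n in sequentially. F_nu R I \<mm> (p ^ n) / ereal (real (p ^ n)) < ereal (real b)"
    by (rule Limsup_lessD)
  then have "\<forall>\<^sub>F n in sequentially. \<mm> [^]\<^bsub>ideals_set R\<^esub> (b * p ^ n) \<subseteq> frobenius_power R I (p ^ n)"
  proof eventually_elim
    case (elim n)
    show ?case
    proof (rule ccontr)
      assume "\<not> \<mm> [^]\<^bsub>ideals_set R\<^esub> (b * p ^ n) \<subseteq> frobenius_power R I (p ^ n)"
      from F_nu_ge[OF this]
      have "ereal (real b) \<le> F_nu R I \<mm> (p ^ n) / ereal (real (p ^ n))"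
        using \<open>p > 0\<close> by (simp add: ereal_le_divide_pos mult.commute)
      with elim show False by simp
    qed
  qed
  with fr show False ..
qed

text \<open>This rounding is the source of the gap of one in the theorem: the first integer strictly
  above a finite \<open>c\<close> must belong to \<open>B\<close>, and it is at most
  \<open>c + 1\<close>.\<close>

lemma Inf_nat_minus_one_le:
  fixes c :: ereal
  assumes "0 \<le> c" and "\<And>b. b \<notin> B \<Longrightarrow> ereal (real b) \<le> c"
  shows "Inf {ereal (real b) | b. b \<in> B} - 1 \<le> c"
proof (cases "c = \<infinity>")
  case False
  then obtain r where r: "c = ereal r" "r \<ge> 0" using assms(1) by (cases c) auto
  \<comment> \<open>Floor plus one, and not the ceiling, keeps \<open>b\<close> strictly above
    \<open>r\<close> when \<open>r\<close> is an integer. Since \<open>r\<close> is nonnegative,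
    \<open>nat\<close> truncates nothing.\<close>
  define b where "b = nat (floor r) + 1"
  have "real b > r" "real b \<le> r + 1" using r(2) by (auto simp: b_def) linarith+
  then have "b \<in> B" using assms(2)[of b] r by force
  then have "Inf {ereal (real b) | b. b \<in> B} \<le> ereal (real b)" by (intro Inf_lower) auto
  also have "\<dots> \<le> c + 1" using \<open>real b \<le> r + 1\<close> r by (simp add: one_ereal_def)
  finally show ?thesis by (simp add: ereal_minus_le)
qed simp

theorem mainTheorem9:
  fixes R :: "('a, 'b) ring_scheme" and \<mm> I :: "'a set" and p :: nat
  assumes "(noetherian_ring R \<and> local_ring R \<mm>) \<or>
      (\<exists>K \<G>. standard_graded_algebra K R \<G> \<and> \<mm> = irrelevant_ideal R \<G>)"
    and "Factorial_Ring.prime p" and "ring_char R = p"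
    and "is_primary_to R \<mm> I"
    and "F_threshold_exists R p I \<mm>"
  shows "c_number R \<mm> p I - 1 \<le> F_threshold R p I \<mm> \<and>
      F_threshold R p I \<mm> \<le> c_number R \<mm> p I"
proof -
  have "cring R"
    using assms(1) by (auto simp: local_ring_def standard_graded_algebra_def)
  then interpret cring R .
  \<comment> \<open>The local and the graded case merge here: \<open>\<mm>\<close> is finitely
    generated, by the Noetherian property in the first case and by the degree-one generators in the
    second.\<close>
  obtain S where S: "finite S" "S \<subseteq> carrier R" "\<mm> = Idl\<^bsub>R\<^esub> S"
    using assms(1)
  proof
    assume "noetherian_ring R \<and> local_ring R \<mm>"
    then show thesis
      using that noetherian_ring.finetely_gen[of R \<mm>]
      by (auto simp: local_ring_def maximalideal_def)
  next
    assume "\<exists>K \<G>. standard_graded_algebra K R \<G> \<and> \<mm> = irrelevant_ideal R \<G>"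
    then show thesis
      using that standard_graded_algebra.irrelevant_ideal_finitely_generated assms(4) by metis
  qed
  have m: "ideal \<mm> R" using S genideal_ideal by simp
  have I: "I \<subseteq> carrier R"
    using assms(4) ideal.Icarr[of I R] by (auto simp: is_primary_to_def primary_ideal_def)
  have p: "p > 0" using assms(2) by (simp add: prime_gt_0_nat)
  define B where "B = {b::nat. \<forall>\<^sub>F n in sequentially.
      \<mm> [^]\<^bsub>ideals_set R\<^esub> (b * p ^ n) \<subseteq> frobenius_power R I (p ^ n)}"
  have c: "c_number R \<mm> p I = Inf {ereal (real b) | b. b \<in> B}"
    using c_number_eq[OF I m, of p] primary_pow_subset_frobenius_power[OF S(1,2)] assms(4) S(3)
    by (simp add: B_def)
  have upper: "c_plus R p I \<mm> \<le> ereal (real b)" if "b \<in> B" for b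
    using c_plus_le[OF m p] that by (simp add: B_def)
  have lower: "ereal (real b) \<le> c_plus R p I \<mm>" if "b \<notin> B" for b
    using c_plus_ge[OF p] that by (simp add: B_def)
  \<comment> \<open>The zeroth power of \<open>\<mm>\<close> is the whole ring, which no Frobenius
    power of the proper ideal \<open>I\<close> contains. This gives the nonnegativity of the limsup
    that the rounding requires.\<close>
  have "0 \<notin> B"
  proof
    assume "0 \<in> B"
    then obtain n where "carrier R \<subseteq> frobenius_power R I (p ^ n)"
      unfolding B_def eventually_sequentially by auto
    moreover have "frobenius_power R I (p ^ n) \<subseteq> I"
      using assms(4) p
      by (intro frobenius_power_subset) (auto simp: is_primary_to_def primary_ideal_def)
    ultimately show False
      using assms(4) I primary_ideal.proper unfolding is_primary_to_def by blast
  qed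
  then have "0 \<le> c_plus R p I \<mm>" using lower[of 0] by (simp add: zero_ereal_def)
  \<comment> \<open>For the second inequality the limsup is a lower bound of all admissible
    \<open>b\<close>; for empty \<open>B\<close> the infimum is \<infinity> and the bound is
    trivial.\<close>
  then show ?thesis
    unfolding F_threshold_eq_c_plus[OF assms(5)] c
    using Inf_nat_minus_one_le[OF _ lower] by (auto intro!: Inf_greatest upper)
qed

end
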